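(* $\lim_{\xi\to0}q(\xi)=-\infty$ and $\lim_{\xi\to\infty}q(\xi)=0$.
   Context: $D=\{(t,q)\in\mathbb{R}^2:2t-q>1\}$, $D_0=\{(t,q)\in\mathbb{R}^2:2t-q>1,\ 0\le t\le1\}$. Write $[\omega_1,\dots,\omega_n+x]=\cfrac{1}{\omega_1+\cfrac{1}{\ddots+\cfrac{1}{\omega_n+x}}}$. For $(t,q)\in D$, $$P(t,q)=\lim_{n\to\infty}\frac1n\log\sum_{\omega_1=1}^\infty\cdots\sum_{\omega_n=1}^\infty\exp\Big(\sup_{x\in[0,1]}\log\prod_{j=1}^n\omega_j^q\,([\omega_j,\dots,\omega_n+x])^{2t}\Big),$$ a real-analytic function on $D$. For $\xi>0$, $(t(\xi),q(\xi))\in D_0$ is the unique solution in $D_0$ of the system $P(t,q)=q\xi$, $\frac{\partial P}{\partial q}(t,q)=\xi$. *)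

theory Defs
  imports Complex_Main
begin

text \<open>\<open>cf [\<omega>\<^sub>1,\<dots>,\<omega>\<^sub>n] x\<close> is the continued fraction $[\omega_1,\dots,\omega_n+x]$, with \<open>x\<close> added
  to the last partial quotient.\<close>

fun cf :: "nat list \<Rightarrow> real \<Rightarrow> real" where
  "cf [] x = x"
| "cf (w # ws) x = 1 / (real w + cf ws x)"

definition D0 :: "(real \<times> real) set" where
  "D0 = {(t, q). 2 * t - q > 1 \<and> 0 \<le> t \<and> t \<le> 1}"

text \<open>The \<open>n\<close>-fold series over \<open>\<omega>\<^sub>1,\<dots>,\<omega>\<^sub>n \<ge> 1\<close>; the summation variable is shifted by \<open>Suc\<close>
  because infinite series are indexed from 0.\<close>

primrec iterated_sum :: "nat \<Rightarrow> (nat list \<Rightarrow> real) \<Rightarrow> real" where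
  "iterated_sum 0 f = f []"
| "iterated_sum (Suc n) f = (\<Sum>k. iterated_sum n (\<lambda>ws. f (Suc k # ws)))"

text \<open>List positions start at 0, so \<open>drop j ws\<close> is $\omega_{j+1},\dots,\omega_n$.\<close>

definition weight :: "real \<Rightarrow> real \<Rightarrow> nat list \<Rightarrow> real \<Rightarrow> real" where
  "weight t q ws x =
     (\<Prod>j<length ws. real (ws ! j) powr q * cf (drop j ws) x powr (2 * t))"

definition pressure :: "real \<Rightarrow> real \<Rightarrow> real" where
  "pressure t q =
     lim (\<lambda>n. 1 / real n *
       ln (iterated_sum n (\<lambda>ws. exp (SUP x\<in>{0..1}. ln (weight t q ws x)))))"

text \<open>The equation $\partial P/\partial q = \xi$ includes the existence of the derivative.\<close>

definition solves_system :: "real \<Rightarrow> real \<Rightarrow> real \<Rightarrow> bool" where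
  "solves_system \<xi> t q \<longleftrightarrow>
     pressure t q = q * \<xi> \<and> ((\<lambda>s. pressure t s) has_real_derivative \<xi>) (at q)"

definition unique_solution_D0 :: "real \<Rightarrow> real \<Rightarrow> real \<Rightarrow> bool" where
  "unique_solution_D0 \<xi> t q \<longleftrightarrow>
     (t, q) \<in> D0 \<and> solves_system \<xi> t q \<and>
     (\<forall>t' q'. (t', q') \<in> D0 \<and> solves_system \<xi> t' q' \<longrightarrow> t' = t \<and> q' = q)"

end

theory Submission
  imports Defs "HOL-Analysis.Analysis" "HOL-Real_Asymp.Real_Asymp"
begin

text \<open>
  Write $\zeta(a) = \sum_{k \ge 1} k^{-a}$. Since $[\omega_j,\dots,\omega_n+x]$ lies between
  $1/(2\omega_j)$ and $1/\omega_j$, one has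
  $\log\zeta(2t-q) - t\log 4 \le P(t,q) \le \log\zeta(2t-q)$ for $t \ge 0$. By Hoelder's inequality
  $P(t,\cdot)$ is convex, so at a solution of the system its graph lies above the tangent through
  $(q, q\xi)$ of slope $\xi$, that is, $P(t,s) \ge \xi s$ for every $s < 2t-1$.

  For $\xi \to \infty$, the lower bound on $P(t,q) = q\xi$ gives $q \ge -\log 4/\xi$, while
  $q \ge y > 0$ would give $\xi y/2 \le P(t,y/2) \le \log\zeta(1+y/2)$.

  For $\xi \to 0$, the subadditive bound $2P(t,q) \le \log(\zeta(2t-q)^2 + 4^{-t} - 1)$, coming from
  words of length two, makes $P(t,-K)$ negative for large $K$, uniformly for $t \ge \tau > 0$; this
  contradicts $P(t,-K) \ge -K\xi$, so $t \to 0$. If moreover $q \ge -M$, the lower bound gives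
  $P(t,q) > 0$, although $q < 2t - 1 < 0$ and $P(t,q) = q\xi$.
\<close>

section \<open>Iterated series\<close>

text \<open>These are exactly the lists at which \<open>iterated_sum n f\<close> evaluates
  \<open>f\<close>, its letters being of the form \<open>Suc k\<close>.\<close>

definition words :: "nat \<Rightarrow> nat list set" where
  "words n = {ws. length ws = n \<and> 0 \<notin> set ws}"

lemma Nil_in_words [simp]: "[] \<in> words n \<longleftrightarrow> n = 0"
  by (auto simp: words_def)

lemma Suc_Cons_in_words [simp]: "Suc k # ws \<in> words (Suc n) \<longleftrightarrow> ws \<in> words n"
  by (auto simp: words_def)

lemma append_in_words: "u \<in> words n \<Longrightarrow> v \<in> words m \<Longrightarrow> u @ v \<in> words (n + m)"
  by (auto simp: words_def)

lemma words_Suc_cases: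
  assumes "ws \<in> words (Suc n)"
  obtains k vs where "ws = Suc k # vs" "vs \<in> words n"
  using assms unfolding words_def
  by (cases ws; cases "hd ws") auto

lemma iterated_sum_cong:
  "(\<And>ws. ws \<in> words n \<Longrightarrow> f ws = g ws) \<Longrightarrow> iterated_sum n f = iterated_sum n g"
proof (induction n arbitrary: f g)
  case (Suc n)
  have "iterated_sum n (\<lambda>ws. f (Suc k # ws)) = iterated_sum n (\<lambda>ws. g (Suc k # ws))" for k
    by (rule Suc.IH) (simp add: Suc.prems)
  then show ?case by simp
qed simp

lemma iterated_sum_append:
  "iterated_sum (n + m) f = iterated_sum n (\<lambda>u. iterated_sum m (\<lambda>v. f (u @ v)))"
  by (induction n arbitrary: f) simp_all

text \<open>A divergent \<open>suminf\<close> has an unspecified value, so linearity and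
  monotonicity of \<open>iterated_sum\<close> require summability at every level of nesting.
  Domination by a multiple of the product of a summable one-letter majorant provides it, and is
  inherited when the first letter is fixed. Only values of \<open>g\<close> at positive integers
  matter.\<close>

locale summable_majorant =
  fixes g :: "nat \<Rightarrow> real"
  assumes majorant_nonneg: "\<And>k. 0 \<le> g (Suc k)"
    and majorant_summable: "summable (\<lambda>k. g (Suc k))"
begin

definition dominated :: "nat \<Rightarrow> (nat list \<Rightarrow> real) \<Rightarrow> bool" where
  "dominated n f \<longleftrightarrow> (\<exists>C. \<forall>ws\<in>words n. \<bar>f ws\<bar> \<le> C * prod_list (map g ws))"

lemma prod_majorant_nonneg: "ws \<in> words n \<Longrightarrow> 0 \<le> prod_list (map g ws)"
proof (induction n arbitrary: ws)
  case (Suc n)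
  then show ?case
    by (elim words_Suc_cases) (simp add: majorant_nonneg)
qed (auto simp: words_def)

text \<open>Fixing the first letter \<open>Suc k\<close> changes the constant \<open>C\<close> into
  \<open>C * g (Suc k)\<close>, so the induction must leave \<open>C\<close> arbitrary; each level
  then contributes one factor, the total of the majorant.\<close>

lemma abs_iterated_sum_le:
  assumes "\<And>ws. ws \<in> words n \<Longrightarrow> \<bar>f ws\<bar> \<le> C * prod_list (map g ws)"
  shows "\<bar>iterated_sum n f\<bar> \<le> C * (\<Sum>k. g (Suc k)) ^ n"
  using assms
proof (induction n arbitrary: f C)
  case (Suc n)
  let ?G = "\<Sum>k. g (Suc k)" and ?a = "\<lambda>k. iterated_sum n (\<lambda>ws. f (Suc k # ws))"
  have le: "\<bar>?a k\<bar> \<le> (C * ?G ^ n) * g (Suc k)" for k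
  proof -
    have "\<bar>f (Suc k # ws)\<bar> \<le> (C * g (Suc k)) * prod_list (map g ws)" if "ws \<in> words n" for ws
      using Suc.prems[of "Suc k # ws"] that by (simp add: mult.assoc)
    from Suc.IH[OF this] show ?thesis by (simp add: mult_ac)
  qed
  have sm: "summable (\<lambda>k. (C * ?G ^ n) * g (Suc k))"
    by (intro summable_mult majorant_summable)
  have sa: "summable (\<lambda>k. \<bar>?a k\<bar>)"
    by (rule summable_comparison_test'[OF sm]) (use le in simp)
  have "\<bar>suminf ?a\<bar> \<le> (\<Sum>k. \<bar>?a k\<bar>)" by (rule summable_rabs[OF sa])
  also have "\<dots> \<le> (\<Sum>k. (C * ?G ^ n) * g (Suc k))" by (rule suminf_le[OF le sa sm])
  also have "\<dots> = (C * ?G ^ n) * ?G" by (rule suminf_mult[OF majorant_summable])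
  finally show ?case by (simp add: mult_ac)
next
  case 0
  from 0[of "[]"] show ?case by simp
qed

lemma dominated_Cons:
  assumes "dominated (Suc n) f"
  shows "dominated n (\<lambda>ws. f (Suc k # ws))"
proof -
  obtain C where C: "\<And>ws. ws \<in> words (Suc n) \<Longrightarrow> \<bar>f ws\<bar> \<le> C * prod_list (map g ws)"
    using assms unfolding dominated_def by blast
  have "\<bar>f (Suc k # ws)\<bar> \<le> (C * g (Suc k)) * prod_list (map g ws)" if "ws \<in> words n" for ws
    using C[of "Suc k # ws"] that by (simp add: mult.assoc)
  then show ?thesis unfolding dominated_def by blast
qed

lemma dominated_summable:
  assumes "dominated (Suc n) f"
  shows "summable (\<lambda>k. iterated_sum n (\<lambda>ws. f (Suc k # ws)))"
proof -
  let ?G = "\<Sum>k. g (Suc k)"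
  obtain C where C: "\<And>ws. ws \<in> words (Suc n) \<Longrightarrow> \<bar>f ws\<bar> \<le> C * prod_list (map g ws)"
    using assms unfolding dominated_def by blast
  have "\<bar>f (Suc k # ws)\<bar> \<le> (C * g (Suc k)) * prod_list (map g ws)" if "ws \<in> words n" for ws k
    using C[of "Suc k # ws"] that by (simp add: mult.assoc)
  then have "\<bar>iterated_sum n (\<lambda>ws. f (Suc k # ws))\<bar> \<le> (C * g (Suc k)) * ?G ^ n" for k
    by (rule abs_iterated_sum_le)
  then show ?thesis
    by (intro summable_comparison_test'[OF summable_mult[OF majorant_summable, of "C * ?G ^ n"]])
       (simp add: mult_ac)
qed

lemma dominated_add:
  assumes "dominated n f" "dominated n h"
  shows "dominated n (\<lambda>ws. f ws + h ws)"
proof -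
  obtain C D where "\<And>ws. ws \<in> words n \<Longrightarrow> \<bar>f ws\<bar> \<le> C * prod_list (map g ws)"
    "\<And>ws. ws \<in> words n \<Longrightarrow> \<bar>h ws\<bar> \<le> D * prod_list (map g ws)"
    using assms unfolding dominated_def by blast
  then have "\<bar>f ws + h ws\<bar> \<le> (C + D) * prod_list (map g ws)" if "ws \<in> words n" for ws
    using that by (smt (verit) distrib_right)
  then show ?thesis unfolding dominated_def by blast
qed

lemma dominated_cmult:
  assumes "dominated n f"
  shows "dominated n (\<lambda>ws. c * f ws)"
proof -
  obtain C where C: "\<And>ws. ws \<in> words n \<Longrightarrow> \<bar>f ws\<bar> \<le> C * prod_list (map g ws)"
    using assms unfolding dominated_def by blast
  have "\<bar>c * f ws\<bar> \<le> (\<bar>c\<bar> * C) * prod_list (map g ws)" if "ws \<in> words n" for ws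
    using mult_left_mono[OF C[OF that], of "\<bar>c\<bar>"] by (simp add: abs_mult mult.assoc)
  then show ?thesis unfolding dominated_def by blast
qed

lemma dominated_prod: "dominated n (\<lambda>ws. prod_list (map g ws))"
  unfolding dominated_def by (rule exI[of _ 1]) (simp add: prod_majorant_nonneg)

lemma dominated_le:
  assumes "dominated n h" "\<And>ws. ws \<in> words n \<Longrightarrow> 0 \<le> f ws" "\<And>ws. ws \<in> words n \<Longrightarrow> f ws \<le> h ws"
  shows "dominated n f"
proof -
  obtain C where C: "\<And>ws. ws \<in> words n \<Longrightarrow> \<bar>h ws\<bar> \<le> C * prod_list (map g ws)"
    using assms(1) unfolding dominated_def by blast
  have "\<bar>f ws\<bar> \<le> C * prod_list (map g ws)" if "ws \<in> words n" for ws
    using C[OF that] assms(2,3)[OF that] by linarith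
  then show ?thesis unfolding dominated_def by blast
qed

lemma iterated_sum_add:
  "dominated n f \<Longrightarrow> dominated n h \<Longrightarrow>
    iterated_sum n (\<lambda>ws. f ws + h ws) = iterated_sum n f + iterated_sum n h"
proof (induction n arbitrary: f h)
  case (Suc n)
  then show ?case
    by (simp add: dominated_Cons dominated_summable suminf_add[symmetric])
qed simp

lemma iterated_sum_cmult:
  "dominated n f \<Longrightarrow> iterated_sum n (\<lambda>ws. c * f ws) = c * iterated_sum n f"
proof (induction n arbitrary: f)
  case (Suc n)
  then show ?case
    by (simp add: dominated_Cons dominated_summable suminf_mult)
qed simp

lemma iterated_sum_mono:
  "dominated n f \<Longrightarrow> dominated n h \<Longrightarrow> (\<And>ws. ws \<in> words n \<Longrightarrow> f ws \<le> h ws) \<Longrightarrow>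
    iterated_sum n f \<le> iterated_sum n h"
proof (induction n arbitrary: f h)
  case (Suc n)
  then show ?case
    by (auto intro!: suminf_le dominated_summable Suc.IH dominated_Cons)
qed simp

lemma iterated_sum_prod:
  "iterated_sum n (\<lambda>ws. prod_list (map g ws)) = (\<Sum>k. g (Suc k)) ^ n"
proof (induction n)
  case (Suc n)
  then show ?case
    by (simp add: iterated_sum_cmult dominated_prod suminf_mult2[symmetric] majorant_summable)
qed simp

end

section \<open>Subadditive sequences\<close>

lemma subadditive_imp_mult_le:
  fixes a :: "nat \<Rightarrow> real"
  assumes "\<And>m n. a (m + n) \<le> a m + a n" "a 0 = 0"
  shows "a (k * m) \<le> real k * a m"
proof (induction k)
  case (Suc k)
  have "a (m + k * m) \<le> a m + a (k * m)" by (rule assms)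
  with Suc show ?case by (simp add: algebra_simps)
qed (simp add: assms)

text \<open>Fekete's lemma. The limit is the infimum of \<open>a m / real m\<close>, which the
  linear lower bound keeps finite; the second conclusion lets any single index bound the limit from
  above.\<close>

lemma subadditive_imp_limit:
  fixes a :: "nat \<Rightarrow> real"
  assumes sub: "\<And>m n. a (m + n) \<le> a m + a n" and zero: "a 0 = 0"
    and lower: "\<And>n. real n * c \<le> a n"
  obtains L where "(\<lambda>n. a n / real n) \<longlonglongrightarrow> L" "\<And>m. m > 0 \<Longrightarrow> L \<le> a m / real m"
proof -
  define L where "L = (INF n\<in>{0<..}. a n / real n)"
  have bdd: "bdd_below ((\<lambda>n. a n / real n) ` {0<..})"
    by (rule bdd_belowI2[of _ c]) (use lower in \<open>auto simp: field_simps\<close>)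
  have L_le: "L \<le> a m / real m" if "m > 0" for m
    unfolding L_def by (rule cINF_lower[OF bdd]) (use that in simp)
  have "(\<lambda>n. a n / real n) \<longlonglongrightarrow> L"
  proof (rule order_tendstoI)
    fix y assume "y < L"
    show "\<forall>\<^sub>F n in sequentially. y < a n / real n"
      using eventually_gt_at_top[of 0]
    proof eventually_elim
      case (elim n)
      from \<open>y < L\<close> L_le[OF elim] show ?case by (rule less_le_trans)
    qed
  next
    fix y assume "L < y"
    then obtain m where m: "m > 0" "a m / real m < y"
      unfolding L_def by (subst (asm) cINF_less_iff) (use bdd in auto)
    \<comment> \<open>An error bound uniform in \<open>n\<close>:
      \<open>real m * \<bar>a 1\<bar>\<close> for the remainder of length \<open>n mod m\<close>,
      and \<open>\<bar>a m\<bar>\<close> for replacing \<open>n div m\<close> by the exact quotient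
      \<open>n / m\<close>.\<close>
    define K where "K = \<bar>a m\<bar> + real m * \<bar>a 1\<bar>"
    have upper: "a n / real n \<le> a m / real m + K / real n" if "n > 0" for n
    proof -
      \<comment> \<open>Cut \<open>n\<close> into \<open>n div m\<close> blocks of length
        \<open>m\<close> and \<open>n mod m\<close> blocks of length 1.\<close>
      have "a n = a (n div m * m + n mod m)" by simp
      also have "\<dots> \<le> a (n div m * m) + a (n mod m * 1)" by (subst mult_1_right) (rule sub)
      also have "\<dots> \<le> real (n div m) * a m + real (n mod m) * a 1"
        by (intro add_mono subadditive_imp_mult_le sub zero)
      finally have 1: "a n \<le> real (n div m) * a m + real (n mod m) * a 1" .
      have r: "real (n mod m) \<le> real m" using m by (simp add: less_imp_le)
      have "real (n mod m) * a 1 \<le> real (n mod m) * \<bar>a 1\<bar>" by (intro mult_left_mono) auto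
      also have "\<dots> \<le> real m * \<bar>a 1\<bar>" by (intro mult_right_mono r) auto
      finally have 2: "real (n mod m) * a 1 \<le> real m * \<bar>a 1\<bar>" .
      have n: "real n = real (n div m) * real m + real (n mod m)"
        by (metis div_mult_mod_eq of_nat_add of_nat_mult)
      have 3: "real (n div m) * a m = real n * (a m / real m) - real (n mod m) * (a m / real m)"
        unfolding n using m by (simp add: field_simps)
      have "- (real (n mod m) * (a m / real m)) \<le> \<bar>real (n mod m) * (a m / real m)\<bar>"
        by (rule abs_ge_minus_self)
      also have "\<dots> = real (n mod m) * (\<bar>a m\<bar> / real m)" by (simp add: abs_mult)
      also have "\<dots> \<le> real m * (\<bar>a m\<bar> / real m)" by (intro mult_right_mono r) auto
      also have "\<dots> = \<bar>a m\<bar>" using m by simp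
      finally have 4: "- (real (n mod m) * (a m / real m)) \<le> \<bar>a m\<bar>" .
      have "a n \<le> real n * (a m / real m) + K" using 1 2 3 4 by (simp add: K_def)
      then show ?thesis using that by (simp add: field_simps)
    qed
    have "(\<lambda>n. a m / real m + K / real n) \<longlonglongrightarrow> a m / real m + 0"
      by (intro tendsto_intros lim_const_over_n)
    then have "\<forall>\<^sub>F n in sequentially. a m / real m + K / real n < y"
      using m by (intro order_tendstoD) auto
    then show "\<forall>\<^sub>F n in sequentially. a n / real n < y"
      using eventually_gt_at_top[of 0]
    proof eventually_elim
      case (elim n)
      show ?case by (rule le_less_trans[OF upper[OF elim(2)] elim(1)])
    qed
  qed
  with L_le that show ?thesis by blast
qed

section \<open>The Dirichlet series\<close>

definition zeta_real :: "real \<Rightarrow> real" where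
  "zeta_real a = (\<Sum>k. real (Suc k) powr (-a))"

lemma summable_zeta_real: "a > 1 \<Longrightarrow> summable (\<lambda>k. real (Suc k) powr (-a))"
  using summable_Suc_iff[of "\<lambda>n. real n powr (-a)"] by (simp add: summable_real_powr_iff)

text \<open>Keep the first two terms. The second one bounds \<open>ln (zeta_real a)\<close> away
  from 0 as long as \<open>a\<close> stays bounded.\<close>

lemma zeta_real_ge:
  assumes "a > 1"
  shows "1 + 2 powr (-a) \<le> zeta_real a"
proof -
  have "(\<Sum>k<2. real (Suc k) powr (-a)) \<le> zeta_real a"
    unfolding zeta_real_def by (intro sum_le_suminf summable_zeta_real assms) auto
  then show ?thesis by (simp add: numeral_2_eq_2)
qed

lemma zeta_real_ge_1: "a > 1 \<Longrightarrow> 1 \<le> zeta_real a"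
  by (rule order_trans[OF _ zeta_real_ge]) auto

lemma zeta_real_antimono:
  assumes "1 < a" "a \<le> b"
  shows "zeta_real b \<le> zeta_real a"
  unfolding zeta_real_def
  by (intro suminf_le summable_zeta_real powr_mono) (use assms in auto)

text \<open>For \<open>k \<ge> 2\<close> the factor \<open>k powr (2 - a)\<close> is at most
  \<open>2 powr (2 - a)\<close>, so the series without its first term is compared with that of
  \<open>zeta_real 2\<close>.\<close>

lemma zeta_real_le:
  assumes "a \<ge> 2"
  shows "zeta_real a \<le> 1 + 2 powr (2 - a) * zeta_real 2"
proof -
  have le: "real (Suc (Suc k)) powr (-a) \<le> 2 powr (2 - a) * real (Suc (Suc k)) powr (-2)" for k
  proof -
    have "real (Suc (Suc k)) powr (2 - a) \<le> 2 powr (2 - a)"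
      using assms by (intro powr_mono2') auto
    then have "real (Suc (Suc k)) powr (2 - a) * real (Suc (Suc k)) powr (-2)
        \<le> 2 powr (2 - a) * real (Suc (Suc k)) powr (-2)"
      by (intro mult_right_mono) auto
    then show ?thesis by (simp only: powr_add[symmetric]) simp
  qed
  have s2: "summable (\<lambda>k. real (Suc k) powr (-2))" by (rule summable_zeta_real) simp
  have sa: "summable (\<lambda>k. real (Suc k) powr (-a))" using assms by (intro summable_zeta_real) simp
  have s2': "summable (\<lambda>k. real (Suc (Suc k)) powr (-2))"
    using s2 by (subst summable_Suc_iff)
  have sa': "summable (\<lambda>k. real (Suc (Suc k)) powr (-a))"
    using sa by (subst summable_Suc_iff)
  have "zeta_real a = 1 + (\<Sum>k. real (Suc (Suc k)) powr (-a))"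
    unfolding zeta_real_def by (subst suminf_split_head[OF sa]) simp
  also have "(\<Sum>k. real (Suc (Suc k)) powr (-a))
      \<le> (\<Sum>k. 2 powr (2 - a) * real (Suc (Suc k)) powr (-2))"
    by (intro suminf_le le sa' summable_mult s2')
  also have "\<dots> = 2 powr (2 - a) * (\<Sum>k. real (Suc (Suc k)) powr (-2))"
    by (rule suminf_mult[OF s2'])
  also have "(\<Sum>k. real (Suc (Suc k)) powr (-2)) \<le> zeta_real 2"
    unfolding zeta_real_def by (subst suminf_split_head[OF s2]) simp
  finally show ?thesis by simp
qed

lemma zeta_real_tendsto_1: "(zeta_real \<longlongrightarrow> 1) at_top"
proof (rule tendsto_sandwich)
  show "\<forall>\<^sub>F a in at_top. 1 \<le> zeta_real a"
    using eventually_gt_at_top[of 1] by eventually_elim (rule zeta_real_ge_1)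
  show "\<forall>\<^sub>F a in at_top. zeta_real a \<le> 1 + 2 powr (2 - a) * zeta_real 2"
    using eventually_ge_at_top[of 2] by eventually_elim (rule zeta_real_le)
  have "((\<lambda>a::real. 2 powr (2 - a)) \<longlongrightarrow> 0) at_top"
    by real_asymp
  then have "((\<lambda>a. 1 + 2 powr (2 - a) * zeta_real 2) \<longlongrightarrow> 1 + 0 * zeta_real 2) at_top"
    by (intro tendsto_intros)
  then show "((\<lambda>a. 1 + 2 powr (2 - a) * zeta_real 2) \<longlongrightarrow> 1) at_top" by simp
qed simp

section \<open>Weights of continued fraction words\<close>

lemma cf_in_unit_interval:
  "ws \<in> words n \<Longrightarrow> x \<in> {0..1} \<Longrightarrow> cf ws x \<in> {0..1}"
proof (induction n arbitrary: ws)
  case (Suc n)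
  from Suc.prems(1) obtain k vs where ws: "ws = Suc k # vs" "vs \<in> words n"
    by (rule words_Suc_cases)
  with Suc have "cf vs x \<in> {0..1}" by blast
  then show ?case by (simp add: ws(1) divide_le_eq)
qed (simp add: words_def)

lemma cf_append: "cf (u @ v) x = cf u (cf v x)"
  by (induction u) simp_all

lemma weight_Nil [simp]: "weight t q [] x = 1"
  by (simp add: weight_def)

lemma weight_Cons:
  "weight t q (w # ws) x = real w powr q * (1 / (real w + cf ws x)) powr (2 * t) * weight t q ws x"
  unfolding weight_def by (simp add: prod.lessThan_Suc_shift del: prod.lessThan_Suc)

text \<open>Cocycle identity: the suffix \<open>v\<close> influences the factors of \<open>u\<close>
  only through the point \<open>cf v x\<close>.\<close>

lemma weight_append: "weight t q (u @ v) x = weight t q u (cf v x) * weight t q v x"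
  by (induction u) (simp_all add: weight_Cons cf_append mult_ac)

lemma weight_pos: "ws \<in> words n \<Longrightarrow> x \<in> {0..1} \<Longrightarrow> 0 < weight t q ws x"
proof (induction n arbitrary: ws)
  case (Suc n)
  from Suc.prems(1) obtain k vs where ws: "ws = Suc k # vs" "vs \<in> words n"
    by (rule words_Suc_cases)
  have "cf vs x \<ge> 0" using cf_in_unit_interval[OF ws(2) Suc.prems(2)] by simp
  then have "0 < 1 / (real (Suc k) + cf vs x)" by simp
  then show ?case
    unfolding ws(1) weight_Cons using Suc.IH[OF ws(2) Suc.prems(2)] by (intro mult_pos_pos) simp_all
qed (simp add: words_def)

text \<open>The tail \<open>cf vs x\<close> is nonnegative, so each continued fraction is at most
  the reciprocal of its first digit; \<open>t \<ge> 0\<close> preserves the inequality under the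
  power.\<close>

lemma weight_le:
  assumes "0 \<le> t" "x \<in> {0..1}"
  shows "ws \<in> words n \<Longrightarrow> weight t q ws x \<le> prod_list (map (\<lambda>k. real k powr (-(2 * t - q))) ws)"
proof (induction n arbitrary: ws)
  case (Suc n)
  from Suc.prems(1) obtain k vs where ws: "ws = Suc k # vs" "vs \<in> words n"
    by (rule words_Suc_cases)
  have cf: "cf vs x \<ge> 0" using cf_in_unit_interval[OF ws(2) assms(2)] by simp
  have "(1 / (real (Suc k) + cf vs x)) powr (2 * t) \<le> (1 / real (Suc k)) powr (2 * t)"
    using assms cf by (intro powr_mono2 divide_left_mono mult_pos_pos) auto
  also have "\<dots> = real (Suc k) powr (- (2 * t))"
    by (simp add: powr_minus inverse_powr divide_inverse del: of_nat_Suc)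
  finally have "real (Suc k) powr q * (1 / (real (Suc k) + cf vs x)) powr (2 * t)
      \<le> real (Suc k) powr q * real (Suc k) powr (- (2 * t))"
    by (intro mult_left_mono) auto
  also have "\<dots> = real (Suc k) powr (-(2 * t - q))" by (simp only: powr_add[symmetric]) simp
  finally have "real (Suc k) powr q * (1 / (real (Suc k) + cf vs x)) powr (2 * t)
      \<le> real (Suc k) powr (-(2 * t - q))" .
  then show ?case
    unfolding ws(1) weight_Cons list.map prod_list.Cons
    using Suc.IH[OF ws(2)] weight_pos[OF ws(2) assms(2), of t q]
    by (intro mult_mono) (auto simp: less_imp_le)
qed (simp add: words_def)

lemma four_powr_minus: "(4::real) powr (-t) = (1 / 2) powr (2 * t)"
  using ln_realpow[of "2::real" 2] by (simp add: powr_def ln_div)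

text \<open>The tail is at most 1, hence at most the digit \<open>k\<close> in front of it, so the
  denominator is at most \<open>2 * k\<close>. Each letter thus costs a factor
  \<open>(1 / 2) powr (2 * t)\<close>, which is \<open>4 powr (-t)\<close>.\<close>

lemma weight_ge:
  assumes "0 \<le> t" "x \<in> {0..1}"
  shows "ws \<in> words n \<Longrightarrow>
    (4 powr (-t)) ^ n * prod_list (map (\<lambda>k. real k powr (-(2 * t - q))) ws) \<le> weight t q ws x"
proof (induction n arbitrary: ws)
  case (Suc n)
  from Suc.prems(1) obtain k vs where ws: "ws = Suc k # vs" "vs \<in> words n"
    by (rule words_Suc_cases)
  have cf: "cf vs x \<ge> 0" "cf vs x \<le> 1" using cf_in_unit_interval[OF ws(2) assms(2)] by simp_all
  have "4 powr (-t) * real (Suc k) powr (-(2 * t - q))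
      = real (Suc k) powr q * ((1 / 2) powr (2 * t) * real (Suc k) powr (- (2 * t)))"
    by (simp add: four_powr_minus powr_add[symmetric] mult.left_commute del: of_nat_Suc)
  also have "(1 / 2) powr (2 * t) * real (Suc k) powr (- (2 * t)) = (1 / (2 * real (Suc k))) powr (2 * t)"
    by (simp only: powr_minus inverse_powr powr_mult divide_inverse mult_1_left
        inverse_mult_distrib)
  also have "real (Suc k) powr q * \<dots>
      \<le> real (Suc k) powr q * (1 / (real (Suc k) + cf vs x)) powr (2 * t)"
    using assms cf by (intro mult_left_mono powr_mono2 divide_left_mono mult_pos_pos) auto
  finally have "4 powr (-t) * real (Suc k) powr (-(2 * t - q))
      \<le> real (Suc k) powr q * (1 / (real (Suc k) + cf vs x)) powr (2 * t)" .
  moreover have "0 \<le> prod_list (map (\<lambda>k. real k powr (-(2 * t - q))) vs)"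
    by (rule prod_list_nonneg) auto
  ultimately have "(4 powr (-t) * real (Suc k) powr (-(2 * t - q))) *
      ((4 powr (-t)) ^ n * prod_list (map (\<lambda>k. real k powr (-(2 * t - q))) vs)) \<le> weight t q ws x"
    unfolding ws(1) weight_Cons
    using Suc.IH[OF ws(2)] by (intro mult_mono[where a = "_ * _ powr _"]) auto
  then show ?case by (simp add: ws(1) mult_ac)
qed (simp add: words_def)

text \<open>The logarithm of the weight is affine in \<open>q\<close>: the continued fractions do
  not involve \<open>q\<close>, and the exponents \<open>1 - u\<close> and \<open>u\<close> add up
  to 1.\<close>

lemma weight_geometric_mean:
  assumes "x \<in> {0..1}"
  shows "ws \<in> words n \<Longrightarrow>
    weight t ((1 - u) * q + u * r) ws x = weight t q ws x powr (1 - u) * weight t r ws x powr u"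
proof (induction n arbitrary: ws)
  case (Suc n)
  from Suc.prems(1) obtain k vs where ws: "ws = Suc k # vs" "vs \<in> words n"
    by (rule words_Suc_cases)
  define c where "c = (1 / (real (Suc k) + cf vs x)) powr (2 * t)"
  have "cf vs x \<ge> 0" using cf_in_unit_interval[OF ws(2) assms] by simp
  then have "c > 0" by (simp add: c_def)
  then have "c powr (1 - u) * c powr u = c" by (simp add: powr_add[symmetric])
  moreover have "real (Suc k) powr ((1 - u) * q + u * r)
      = (real (Suc k) powr q) powr (1 - u) * (real (Suc k) powr r) powr u"
    by (simp only: powr_powr powr_add mult.commute)
  moreover have "weight t q vs x > 0" "weight t r vs x > 0"
    using weight_pos[OF ws(2) assms] by auto
  ultimately show ?case
    unfolding ws(1) weight_Cons Suc.IH[OF ws(2)] c_def[symmetric]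
    using \<open>c > 0\<close> by (simp add: powr_mult mult_ac)
qed (simp add: words_def)

text \<open>Digits equal to 1 eliminate \<open>q\<close>, and the two continued fractions multiply
  to \<open>1 / (2 + x)\<close>, at most \<open>1 / 2\<close>. \<open>weight_le\<close> would give
  only the bound 1 for this word.\<close>

lemma weight_one_one_le:
  assumes "0 \<le> t" "x \<in> {0..1}"
  shows "weight t q [1, 1] x \<le> 4 powr (-t)"
proof -
  have "weight t q [1, 1] x = (1 / (1 + 1 / (1 + x)) * (1 / (1 + x))) powr (2 * t)"
    using assms by (simp add: weight_Cons powr_mult powr_divide)
  also have "\<dots> \<le> (1 / 2) powr (2 * t)"
    using assms by (intro powr_mono2) (auto simp: field_simps)
  also have "\<dots> = 4 powr (-t)" by (rule four_powr_minus[symmetric])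
  finally show ?thesis .
qed

section \<open>Suprema of the weights over the unit interval\<close>

definition sup_weight :: "real \<Rightarrow> real \<Rightarrow> nat list \<Rightarrow> real" where
  "sup_weight t q ws = exp (SUP x\<in>{0..1}. ln (weight t q ws x))"

text \<open>The outer \<open>exp\<close> yields positivity for every list, including those where the
  supremum is a default value.\<close>

lemma sup_weight_pos [simp]: "0 < sup_weight t q ws"
  by (simp add: sup_weight_def)

lemma sup_weight_leI:
  assumes "ws \<in> words n" "\<And>x. x \<in> {0..1} \<Longrightarrow> weight t q ws x \<le> c"
  shows "sup_weight t q ws \<le> c"
proof -
  have "0 < c" using weight_pos[OF assms(1), of 0 t q] assms(2)[of 0] by simp
  have "(SUP x\<in>{0..1}. ln (weight t q ws x)) \<le> ln c"
    by (rule cSUP_least) (use assms weight_pos[OF assms(1)] in \<open>auto intro!: ln_mono\<close>)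
  then show ?thesis
    unfolding sup_weight_def using \<open>0 < c\<close> by (metis exp_le_cancel_iff exp_ln)
qed

text \<open>A real supremum is an upper bound only for sets bounded above; \<open>weight_le\<close>
  supplies a bound on the weights that is uniform in \<open>x\<close>.\<close>

lemma weight_le_sup_weight:
  assumes "0 \<le> t" "ws \<in> words n" "x \<in> {0..1}"
  shows "weight t q ws x \<le> sup_weight t q ws"
proof -
  let ?c = "prod_list (map (\<lambda>k. real k powr (-(2 * t - q))) ws)"
  have "bdd_above ((\<lambda>x. ln (weight t q ws x)) ` {0..1})"
    using weight_pos[OF assms(2)] weight_le[OF assms(1) _ assms(2)]
    by (intro bdd_aboveI2[of _ _ "ln ?c"] ln_mono) auto
  then have "ln (weight t q ws x) \<le> (SUP x\<in>{0..1}. ln (weight t q ws x))"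
    using assms(3) by (intro cSUP_upper)
  then show ?thesis
    unfolding sup_weight_def using weight_pos[OF assms(2,3)] by (metis exp_le_cancel_iff exp_ln)
qed

text \<open>In the cocycle identity the point \<open>cf v x\<close> lies again in the unit interval,
  so each factor is bounded by its own supremum.\<close>

lemma sup_weight_append_le:
  assumes "0 \<le> t" "u \<in> words n" "v \<in> words m"
  shows "sup_weight t q (u @ v) \<le> sup_weight t q u * sup_weight t q v"
proof (rule sup_weight_leI[OF append_in_words[OF assms(2,3)]])
  fix x :: real assume x: "x \<in> {0..1}"
  show "weight t q (u @ v) x \<le> sup_weight t q u * sup_weight t q v"
    unfolding weight_append
    using assms x cf_in_unit_interval[OF assms(3) x] weight_pos[OF assms(3) x, of t q]
    by (intro mult_mono weight_le_sup_weight) (auto simp: less_imp_le)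
qed

text \<open>The exponent \<open>a\<close> may be smaller than \<open>2 * t - q\<close>, so that one
  majorant can serve several values of \<open>q\<close> simultaneously.\<close>

lemma sup_weight_le:
  assumes "0 \<le> t" "a \<le> 2 * t - q" "ws \<in> words n"
  shows "sup_weight t q ws \<le> prod_list (map (\<lambda>k. real k powr (-a)) ws)"
proof (rule sup_weight_leI[OF assms(3)])
  fix x :: real assume x: "x \<in> {0..1}"
  have "prod_list (map (\<lambda>k. real k powr (-(2 * t - q))) ws) \<le> prod_list (map (\<lambda>k. real k powr (-a)) ws)"
    using assms(3)
  proof (induction n arbitrary: ws)
    case (Suc n)
    from Suc.prems(1) obtain k vs where ws: "ws = Suc k # vs" "vs \<in> words n"
      by (rule words_Suc_cases)
    have "real (Suc k) powr (-(2 * t - q)) \<le> real (Suc k) powr (-a)"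
      using assms by (intro powr_mono) auto
    then show ?case
      unfolding ws(1) list.map prod_list.Cons using Suc.IH[OF ws(2)]
      by (intro mult_mono) (auto intro!: prod_list_nonneg)
  qed (simp add: words_def)
  with weight_le[OF assms(1) x assms(3)] show "weight t q ws x \<le> prod_list (map (\<lambda>k. real k powr (-a)) ws)"
    by (rule order_trans)
qed

lemma sup_weight_ge:
  assumes "0 \<le> t" "ws \<in> words n"
  shows "(4 powr (-t)) ^ n * prod_list (map (\<lambda>k. real k powr (-(2 * t - q))) ws) \<le> sup_weight t q ws"
  using weight_ge[OF assms(1) _ assms(2), of 0 q] weight_le_sup_weight[OF assms, of 0 q] by simp

lemma sup_weight_geometric_mean_le:
  assumes "0 \<le> t" "0 \<le> u" "u \<le> 1" "ws \<in> words n"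
  shows "sup_weight t ((1 - u) * q + u * r) ws \<le> sup_weight t q ws powr (1 - u) * sup_weight t r ws powr u"
proof (rule sup_weight_leI[OF assms(4)])
  fix x :: real assume x: "x \<in> {0..1}"
  show "weight t ((1 - u) * q + u * r) ws x \<le> sup_weight t q ws powr (1 - u) * sup_weight t r ws powr u"
    unfolding weight_geometric_mean[OF x assms(4)]
    using assms weight_le_sup_weight[OF assms(1,4) x] weight_pos[OF assms(4) x]
    by (intro mult_mono powr_mono2) (auto simp: less_imp_le)
qed

section \<open>The pressure\<close>

definition partition_sum :: "real \<Rightarrow> real \<Rightarrow> nat \<Rightarrow> real" where
  "partition_sum t q n = iterated_sum n (sup_weight t q)"

lemma summable_majorant_powr: "1 < a \<Longrightarrow> summable_majorant (\<lambda>k. real k powr (-a))"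
  by unfold_locales (simp_all add: summable_zeta_real del: of_nat_Suc)

lemma sup_weight_dominated:
  assumes "0 \<le> t" "1 < a" "a \<le> 2 * t - q"
  shows "summable_majorant.dominated (\<lambda>k. real k powr (-a)) n (sup_weight t q)"
proof -
  interpret summable_majorant "\<lambda>k. real k powr (-a)"
    by (rule summable_majorant_powr[OF assms(2)])
  show ?thesis
    by (rule dominated_le[OF dominated_prod])
       (use sup_weight_le[OF assms(1,3)] in \<open>auto simp: less_imp_le\<close>)
qed

lemma partition_sum_le:
  assumes "0 \<le> t" "1 < 2 * t - q"
  shows "partition_sum t q n \<le> zeta_real (2 * t - q) ^ n"
proof -
  interpret summable_majorant "\<lambda>k. real k powr (-(2 * t - q))"
    by (rule summable_majorant_powr[OF assms(2)])
  have "iterated_sum n (sup_weight t q) \<le> iterated_sum n (\<lambda>ws. prod_list (map (\<lambda>k. real k powr (-(2 * t - q))) ws))"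
    by (intro iterated_sum_mono sup_weight_dominated dominated_prod sup_weight_le) (use assms in auto)
  then show ?thesis
    unfolding iterated_sum_prod partition_sum_def zeta_real_def .
qed

lemma partition_sum_ge:
  assumes "0 \<le> t" "1 < 2 * t - q"
  shows "(4 powr (-t) * zeta_real (2 * t - q)) ^ n \<le> partition_sum t q n"
proof -
  interpret summable_majorant "\<lambda>k. real k powr (-(2 * t - q))"
    by (rule summable_majorant_powr[OF assms(2)])
  have "iterated_sum n (\<lambda>ws. (4 powr (-t)) ^ n * prod_list (map (\<lambda>k. real k powr (-(2 * t - q))) ws))
      \<le> iterated_sum n (sup_weight t q)"
    by (intro iterated_sum_mono sup_weight_dominated dominated_prod dominated_cmult sup_weight_ge)
       (use assms in auto)
  then show ?thesis
    unfolding iterated_sum_cmult[OF dominated_prod] iterated_sum_prod partition_sum_def zeta_real_def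
    by (simp add: power_mult_distrib)
qed

lemma partition_sum_pos:
  assumes "0 \<le> t" "1 < 2 * t - q"
  shows "0 < partition_sum t q n"
  by (rule less_le_trans[OF _ partition_sum_ge[OF assms]])
     (use zeta_real_ge_1[OF assms(2)] in auto)

lemma partition_sum_0 [simp]: "partition_sum t q 0 = 1"
  by (simp add: partition_sum_def sup_weight_def)

text \<open>The supremum for a word is at most the product of those for its first \<open>n\<close>
  and last \<open>m\<close> letters. Writing this product with \<open>take\<close> and
  \<open>drop\<close> makes it a function of the whole word, to which monotonicity applies; the
  nested sum of the product then factors.\<close>

lemma partition_sum_submultiplicative:
  assumes "0 \<le> t" "1 < 2 * t - q"
  shows "partition_sum t q (n + m) \<le> partition_sum t q n * partition_sum t q m"
proof -
  let ?g = "\<lambda>k. real k powr (-(2 * t - q))" and ?F = "sup_weight t q"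
  interpret summable_majorant ?g
    by (rule summable_majorant_powr[OF assms(2)])
  have dom: "dominated k ?F" for k
    by (intro sup_weight_dominated) (use assms in auto)
  have split: "take n ws \<in> words n" "drop n ws \<in> words m" if "ws \<in> words (n + m)" for ws
    using that by (auto simp: words_def dest: in_set_takeD in_set_dropD)
  have "?F (take n ws) * ?F (drop n ws) \<le> prod_list (map ?g ws)" if ws: "ws \<in> words (n + m)" for ws
  proof -
    have "?F (take n ws) * ?F (drop n ws)
        \<le> prod_list (map ?g (take n ws)) * prod_list (map ?g (drop n ws))"
      using assms(1) split[OF ws]
      by (intro mult_mono sup_weight_le) (auto intro!: prod_list_nonneg simp: less_imp_le)
    also have "\<dots> = prod_list (map ?g (take n ws @ drop n ws))"
      by (simp only: map_append prod_list.append)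
    finally show ?thesis by simp
  qed
  then have "dominated (n + m) (\<lambda>ws. ?F (take n ws) * ?F (drop n ws))"
    by (intro dominated_le[OF dominated_prod]) (auto simp: less_imp_le)
  moreover have "?F ws \<le> ?F (take n ws) * ?F (drop n ws)" if "ws \<in> words (n + m)" for ws
    using sup_weight_append_le[OF assms(1) split[OF that], of q] by simp
  ultimately have "iterated_sum (n + m) ?F
      \<le> iterated_sum (n + m) (\<lambda>ws. ?F (take n ws) * ?F (drop n ws))"
    by (intro iterated_sum_mono dom)
  also have "\<dots> = iterated_sum n (\<lambda>u. iterated_sum m (\<lambda>v. ?F u * ?F v))"
    unfolding iterated_sum_append
    by (intro iterated_sum_cong) (simp add: words_def)
  also have "\<dots> = iterated_sum n (\<lambda>u. iterated_sum m ?F * ?F u)"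
    by (simp only: iterated_sum_cmult[OF dom] mult.commute[of "iterated_sum m ?F"])
  also have "\<dots> = iterated_sum m ?F * iterated_sum n ?F"
    by (rule iterated_sum_cmult[OF dom])
  finally show ?thesis by (simp add: partition_sum_def mult.commute)
qed

text \<open>In the bound by the squared zeta value the word \<open>[1, 1]\<close> is counted as 1,
  while its true contribution is at most \<open>4 powr (-t)\<close>. The indicator \<open>?e\<close>
  corrects this one term.\<close>

lemma partition_sum_2_le:
  assumes "0 \<le> t" "1 < 2 * t - q"
  shows "partition_sum t q 2 \<le> zeta_real (2 * t - q) ^ 2 + (4 powr (-t) - 1)"
proof -
  let ?g = "\<lambda>k. real k powr (-(2 * t - q))" and ?F = "sup_weight t q"
  let ?e = "\<lambda>ws. of_bool (ws = [1, 1::nat]) :: real"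
  interpret summable_majorant ?g
    by (rule summable_majorant_powr[OF assms(2)])
  \<comment> \<open>The product majorant takes the value 1 at \<open>[1, 1]\<close> and is
    nonnegative elsewhere.\<close>
  have dom_e: "dominated 2 ?e"
    by (intro dominated_le[OF dominated_prod]) (auto intro!: prod_list_nonneg)
  have dom_ce: "dominated 2 (\<lambda>ws. (4 powr (-t) - 1) * ?e ws)"
    by (rule dominated_cmult[OF dom_e])
  have le: "?F ws \<le> prod_list (map ?g ws) + (4 powr (-t) - 1) * ?e ws" if ws: "ws \<in> words 2" for ws
  proof (cases "ws = [1, 1]")
    case True
    have "?F ws \<le> 4 powr (-t)"
      by (rule sup_weight_leI[OF ws]) (use weight_one_one_le[OF assms(1)] True in simp)
    then show ?thesis by (simp add: True)
  next
    case False
    then show ?thesis using sup_weight_le[OF assms(1) order_refl ws] by simp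
  qed
  have "iterated_sum 2 ?F \<le> iterated_sum 2 (\<lambda>ws. prod_list (map ?g ws) + (4 powr (-t) - 1) * ?e ws)"
    by (intro iterated_sum_mono sup_weight_dominated dominated_add dominated_prod dom_ce le)
       (use assms in auto)
  also have "\<dots> = zeta_real (2 * t - q) ^ 2 + (4 powr (-t) - 1) * iterated_sum 2 ?e"
    unfolding iterated_sum_add[OF dominated_prod dom_ce] iterated_sum_cmult[OF dom_e]
      iterated_sum_prod zeta_real_def ..
  also have "iterated_sum 2 ?e = 1"
  proof -
    have "(\<Sum>l. ?e [Suc k, Suc l]) = of_bool (k = 0)" for k
      by (subst suminf_finite[of "{0}"]) auto
    moreover have "(\<Sum>k. of_bool (k = 0)) = (1::real)"
      by (subst suminf_finite[of "{0::nat}"]) auto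
    ultimately show ?thesis by (simp add: numeral_2_eq_2)
  qed
  finally show ?thesis by (simp add: partition_sum_def)
qed

text \<open>Hoelder's inequality, obtained by applying Young's inequality to the normalised summands.\<close>

lemma partition_sum_log_convex:
  assumes "0 \<le> t" "0 \<le> u" "u \<le> 1" "1 < 2 * t - q" "1 < 2 * t - r"
  shows "partition_sum t ((1 - u) * q + u * r) n
    \<le> partition_sum t q n powr (1 - u) * partition_sum t r n powr u"
proof -
  \<comment> \<open>The smaller exponent gives a single majorant for both endpoints and, by
    \<open>ap\<close> below, for the intermediate parameter.\<close>
  define a where "a = min (2 * t - q) (2 * t - r)"
  define A where "A = partition_sum t q n"
  define B where "B = partition_sum t r n"
  let ?p = "(1 - u) * q + u * r" and ?c = "A powr (1 - u) * B powr u"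
  have a: "1 < a" "a \<le> 2 * t - q" "a \<le> 2 * t - r"
    using assms by (auto simp: a_def)
  have "?p \<le> (1 - u) * (2 * t - a) + u * (2 * t - a)"
    using a assms by (intro add_mono mult_left_mono) auto
  then have ap: "a \<le> 2 * t - ?p" by (simp add: algebra_simps)
  have A: "0 < A" and B: "0 < B"
    using assms by (auto simp: A_def B_def intro: partition_sum_pos)
  interpret summable_majorant "\<lambda>k. real k powr (-a)"
    by (rule summable_majorant_powr[OF a(1)])
  have dq: "dominated n (sup_weight t q)" and dr: "dominated n (sup_weight t r)"
    and dp: "dominated n (sup_weight t ?p)"
    using sup_weight_dominated[OF assms(1) a(1)] a ap by auto
  have dom: "dominated n (\<lambda>ws. (?c * (1 - u) / A) * sup_weight t q ws)"
    "dominated n (\<lambda>ws. (?c * u / B) * sup_weight t r ws)"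
    by (intro dominated_cmult dq dr)+
  have "sup_weight t ?p ws \<le> (?c * (1 - u) / A) * sup_weight t q ws + (?c * u / B) * sup_weight t r ws"
    if ws: "ws \<in> words n" for ws
  proof -
    \<comment> \<open>Division by \<open>A\<close> and \<open>B\<close> gives each family total mass
      1, so that summing the Young bound produces the weights \<open>1 - u\<close> and
      \<open>u\<close>.\<close>
    let ?x = "sup_weight t q ws / A" and ?y = "sup_weight t r ws / B"
    have "sup_weight t ?p ws \<le> (A * ?x) powr (1 - u) * (B * ?y) powr u"
      using sup_weight_geometric_mean_le[OF assms(1-3) ws] A B by simp
    also have "\<dots> = ?c * (?x powr (1 - u) * ?y powr u)"
      by (simp only: powr_mult mult_ac)
    also have "\<dots> \<le> ?c * ((1 - u) * ?x + u * ?y)"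
      using A B assms by (intro mult_left_mono Youngs_inequality_0) auto
    finally show ?thesis by (simp add: algebra_simps)
  qed
  then have "partition_sum t ?p n \<le>
      iterated_sum n (\<lambda>ws. (?c * (1 - u) / A) * sup_weight t q ws + (?c * u / B) * sup_weight t r ws)"
    unfolding partition_sum_def by (intro iterated_sum_mono dp dominated_add dom)
  also have "\<dots> = (?c * (1 - u) / A) * A + (?c * u / B) * B"
    unfolding iterated_sum_add[OF dom] iterated_sum_cmult[OF dq] iterated_sum_cmult[OF dr]
    by (simp add: A_def B_def partition_sum_def)
  also have "\<dots> = ?c * (1 - u) + ?c * u" using A B by simp
  also have "\<dots> = ?c" by (simp only: distrib_left[symmetric]) simp
  finally show ?thesis by (simp add: A_def B_def)
qed

text \<open>Fekete's lemma for the logarithms of the partition sums: submultiplicativity gives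
  subadditivity and \<open>partition_sum_ge\<close> the linear lower bound. Convergence gives the
  \<open>lim\<close> in \<open>pressure\<close> its intended meaning.\<close>

lemma pressure_limit:
  assumes "0 \<le> t" "1 < 2 * t - q"
  shows "(\<lambda>n. ln (partition_sum t q n) / real n) \<longlonglongrightarrow> pressure t q"
    and "m > 0 \<Longrightarrow> pressure t q \<le> ln (partition_sum t q m) / real m"
proof -
  let ?a = "\<lambda>n. ln (partition_sum t q n)" and ?c = "4 powr (-t) * zeta_real (2 * t - q)"
  have pos: "0 < partition_sum t q n" for n
    by (rule partition_sum_pos[OF assms])
  have c: "0 < ?c" using zeta_real_ge_1[OF assms(2)] by simp
  have sub: "?a (m + n) \<le> ?a m + ?a n" for m n
  proof -
    have "?a (m + n) \<le> ln (partition_sum t q m * partition_sum t q n)"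
      by (intro ln_mono partition_sum_submultiplicative[OF assms] pos)
    also have "\<dots> = ?a m + ?a n" using pos by (simp add: ln_mult_pos)
    finally show ?thesis .
  qed
  have lower: "real n * ln ?c \<le> ?a n" for n
  proof -
    have "real n * ln ?c = ln (?c ^ n)" using c by (simp only: ln_realpow)
    also have "\<dots> \<le> ?a n" by (intro ln_mono partition_sum_ge[OF assms]) (use c in simp)
    finally show ?thesis .
  qed
  obtain L where L: "(\<lambda>n. ?a n / real n) \<longlonglongrightarrow> L" "\<And>m. m > 0 \<Longrightarrow> L \<le> ?a m / real m"
    using subadditive_imp_limit[of ?a, OF sub _ lower] by auto
  have "pressure t q = lim (\<lambda>n. ?a n / real n)"
    unfolding pressure_def partition_sum_def sup_weight_def[abs_def] by simp
  then have "pressure t q = L" using L(1) by (simp add: limI)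
  with L show "(\<lambda>n. ?a n / real n) \<longlonglongrightarrow> pressure t q"
    "m > 0 \<Longrightarrow> pressure t q \<le> ?a m / real m" by auto
qed

section \<open>Bounds for the pressure\<close>

lemma pressure_le:
  assumes "0 \<le> t" "1 < 2 * t - q"
  shows "pressure t q \<le> ln (zeta_real (2 * t - q))"
proof -
  have "pressure t q \<le> ln (partition_sum t q 1)"
    using pressure_limit(2)[OF assms, of 1] by simp
  also have "\<dots> \<le> ln (zeta_real (2 * t - q))"
    using partition_sum_le[OF assms, of 1] by (intro ln_mono partition_sum_pos[OF assms]) simp
  finally show ?thesis .
qed

text \<open>Words of length one cannot show that the pressure is negative, since the word
  \<open>[1]\<close> has weight 1 at \<open>x = 0\<close>. Length two can, through the gain at
  \<open>[1, 1]\<close>.\<close>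

lemma pressure_le_pairs:
  assumes "0 \<le> t" "1 < 2 * t - q"
  shows "2 * pressure t q \<le> ln (zeta_real (2 * t - q) ^ 2 + (4 powr (-t) - 1))"
proof -
  have "2 * pressure t q \<le> ln (partition_sum t q 2)"
    using pressure_limit(2)[OF assms, of 2] by simp
  also have "\<dots> \<le> ln (zeta_real (2 * t - q) ^ 2 + (4 powr (-t) - 1))"
    by (intro ln_mono partition_sum_pos[OF assms] partition_sum_2_le[OF assms])
  finally show ?thesis .
qed

lemma pressure_ge:
  assumes "0 \<le> t" "1 < 2 * t - q"
  shows "ln (zeta_real (2 * t - q)) - t * ln 4 \<le> pressure t q"
proof (rule LIMSEQ_le_const[OF pressure_limit(1)[OF assms]], intro exI[of _ 1] allI impI)
  \<comment> \<open>The comparison starts at \<open>n = 1\<close>, because at \<open>n = 0\<close>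
    the quotient is 0 by the convention for division by zero.\<close>
  fix n :: nat assume n: "1 \<le> n"
  let ?z = "zeta_real (2 * t - q)"
  have z: "1 \<le> ?z" by (rule zeta_real_ge_1[OF assms(2)])
  have "ln (4 powr (-t) * ?z) = ln ?z - t * ln 4"
    using z by (subst ln_mult_pos) (auto simp: ln_powr)
  then have "real n * (ln ?z - t * ln 4) = ln ((4 powr (-t) * ?z) ^ n)"
    using z by (subst ln_realpow) auto
  also have "\<dots> \<le> ln (partition_sum t q n)"
    by (intro ln_mono partition_sum_ge[OF assms]) (use z in auto)
  finally show "ln ?z - t * ln 4 \<le> ln (partition_sum t q n) / real n"
    using n by (simp add: field_simps)
qed

text \<open>Hoelder's inequality makes the normalised logarithms convex in \<open>q\<close> at each
  level \<open>n\<close>, and pointwise limits preserve convexity.\<close>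

lemma convex_on_pressure:
  assumes "0 \<le> t"
  shows "convex_on {..<2 * t - 1} (pressure t)"
proof (rule convex_onI)
  fix u q r :: real
  assume u: "0 < u" "u < 1" and "q \<in> {..<2 * t - 1}" "r \<in> {..<2 * t - 1}"
  then have q: "1 < 2 * t - q" and r: "1 < 2 * t - r" by auto
  let ?p = "(1 - u) * q + u * r"
  have "?p < 2 * t - 1"
    using u q r convex_bound_lt[of q "2 * t - 1" r "1 - u" u] by simp
  then have p: "1 < 2 * t - ?p" by simp
  have "ln (partition_sum t ?p n) / real n
      \<le> (1 - u) * (ln (partition_sum t q n) / real n) + u * (ln (partition_sum t r n) / real n)" for n
  proof -
    have "ln (partition_sum t ?p n) \<le> ln (partition_sum t q n powr (1 - u) * partition_sum t r n powr u)"
      using u by (intro ln_mono partition_sum_log_convex partition_sum_pos assms p q r) auto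
    also have "\<dots> = (1 - u) * ln (partition_sum t q n) + u * ln (partition_sum t r n)"
      using partition_sum_pos[OF assms q, of n] partition_sum_pos[OF assms r, of n]
      by (subst ln_mult_pos) (auto simp: ln_powr)
    finally have "ln (partition_sum t ?p n) / real n
        \<le> ((1 - u) * ln (partition_sum t q n) + u * ln (partition_sum t r n)) / real n"
      by (rule divide_right_mono) simp
    then show ?thesis by (simp add: add_divide_distrib)
  qed
  then have "pressure t ?p \<le> (1 - u) * pressure t q + u * pressure t r"
    by (intro LIMSEQ_le[OF pressure_limit(1)[OF assms p]
          tendsto_add[OF tendsto_mult_left[OF pressure_limit(1)[OF assms q]]
            tendsto_mult_left[OF pressure_limit(1)[OF assms r]]]]) blast
  then show "pressure t ((1 - u) *\<^sub>R q + u *\<^sub>R r) \<le> (1 - u) * pressure t q + u * pressure t r"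
    by simp
qed simp

text \<open>The tangent at \<open>q\<close> has slope \<open>\<xi>\<close> and value
  \<open>q * \<xi>\<close> there, so it passes through the origin. The resulting inequality can be
  tested at any admissible \<open>s\<close>, independently of the unknown \<open>q\<close>.\<close>

lemma solves_system_imp_pressure_ge:
  assumes "solves_system \<xi> t q" "0 \<le> t" "1 < 2 * t - q" "1 < 2 * t - s"
  shows "\<xi> * s \<le> pressure t s"
proof -
  have "(pressure t has_real_derivative \<xi>) (at q within {..<2 * t - 1})"
    using assms(1) unfolding solves_system_def by (blast intro: has_field_derivative_at_within)
  then have "\<xi> * (s - q) \<le> pressure t s - pressure t q"
    using assms by (intro convex_on_imp_above_tangent[OF convex_on_pressure]) (auto simp: interior_open)
  moreover have "pressure t q = q * \<xi>" using assms(1) by (simp add: solves_system_def)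
  ultimately show ?thesis by (simp add: algebra_simps)
qed

section \<open>Asymptotics of the solution\<close>

theorem proposition5p1:
  fixes t q :: "real \<Rightarrow> real"
  assumes "\<And>\<xi>. \<xi> > 0 \<Longrightarrow> unique_solution_D0 \<xi> (t \<xi>) (q \<xi>)"
  shows "filterlim q at_bot (at_right 0) \<and> (q \<longlongrightarrow> 0) at_top"
proof
  have t: "0 \<le> t \<xi>" "t \<xi> \<le> 1" and dom: "1 < 2 * t \<xi> - q \<xi>"
    and sol: "solves_system \<xi> (t \<xi>) (q \<xi>)" and eq: "pressure (t \<xi>) (q \<xi>) = q \<xi> * \<xi>"
    if "\<xi> > 0" for \<xi>
    using assms[OF that] by (auto simp: unique_solution_D0_def D0_def solves_system_def)
  have tangent: "\<xi> * s \<le> pressure (t \<xi>) s" if "\<xi> > 0" "1 < 2 * t \<xi> - s" for \<xi> s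
    using solves_system_imp_pressure_ge[OF sol t(1) dom] that by blast

  show "filterlim q at_bot (at_right 0)"
    unfolding filterlim_at_bot_dense
  proof
    fix Z :: real
    \<comment> \<open>If \<open>q \<xi> \<ge> Z\<close> then \<open>q \<xi> \<ge> - M\<close>, and
      \<open>t \<xi> \<le> 1\<close> gives \<open>2 * t \<xi> - q \<xi> \<le> M + 2\<close>. Hence
      \<open>b\<close> is a lower bound for the logarithm of the zeta value.\<close>
    define M where "M = max 0 (- Z)"
    define b where "b = ln (1 + 2 powr (-(M + 2)))"
    have "b > 0" unfolding b_def by (intro ln_gt_zero) simp
    \<comment> \<open>Below this threshold for \<open>t \<xi>\<close>, the loss
      \<open>t \<xi> * ln 4\<close> is less than \<open>b\<close>, and
      \<open>2 * t \<xi> - 1\<close> is negative.\<close>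
    define \<tau> where "\<tau> = min (1 / 2) (b / ln 4)"
    have \<tau>: "0 < \<tau>" "\<tau> \<le> 1 / 2" "\<tau> * ln 4 \<le> b"
      using \<open>b > 0\<close> by (auto simp: \<tau>_def min_def field_simps)
    \<comment> \<open>The midpoint between 1 and \<open>4 powr (-\<tau>)\<close>, the latter being
      the limit of the two-letter bound for large arguments.\<close>
    define \<rho> where "\<rho> = (1 + 4 powr (-\<tau>)) / 2"
    have "4 powr (-\<tau>) < (1::real)" using \<tau>(1) by (simp add: powr_less_one)
    then have \<rho>: "0 < \<rho>" "\<rho> < 1" by (auto simp: \<rho>_def add_pos_pos)
    have "((\<lambda>a. zeta_real a ^ 2 + (4 powr (-\<tau>) - 1)) \<longlongrightarrow> 1 ^ 2 + (4 powr (-\<tau>) - 1)) at_top"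
      by (intro tendsto_intros zeta_real_tendsto_1)
    moreover have "1 ^ 2 + (4 powr (-\<tau>) - 1) < \<rho>"
      using \<open>4 powr (-\<tau>) < (1::real)\<close> by (simp add: \<rho>_def)
    ultimately have "\<forall>\<^sub>F a in at_top. zeta_real a ^ 2 + (4 powr (-\<tau>) - 1) < \<rho>"
      by (rule order_tendstoD(2))
    then obtain K0 where K0: "\<And>a. a \<ge> K0 \<Longrightarrow> zeta_real a ^ 2 + (4 powr (-\<tau>) - 1) < \<rho>"
      unfolding eventually_at_top_linorder by blast
    \<comment> \<open>With \<open>K \<ge> 2\<close> the point \<open>-K\<close> is admissible for
      every \<open>t \<ge> 0\<close>.\<close>
    define K where "K = max 2 K0"
    have K: "K \<ge> 2" "K \<ge> K0" by (auto simp: K_def)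
    \<comment> \<open>Chosen so that \<open>\<xi> < \<xi>0\<close> forces
      \<open>2 * (\<xi> * (-K)) > ln \<rho>\<close>, against the two-letter upper bound at
      \<open>-K\<close>.\<close>
    define \<xi>0 where "\<xi>0 = - ln \<rho> / (2 * K)"
    have "0 < \<xi>0" using \<rho> K by (simp add: \<xi>0_def divide_neg_pos)
    have "q \<xi> < Z" if \<xi>: "0 < \<xi>" "\<xi> < \<xi>0" for \<xi>
    proof (rule ccontr)
      assume "\<not> q \<xi> < Z"
      then have qM: "- M \<le> q \<xi>" by (auto simp: M_def)
      note t = t[OF \<xi>(1)] and dom = dom[OF \<xi>(1)]
      show False
      proof (cases "t \<xi> < \<tau>")
        case True
        have "1 + 2 powr (-(M + 2)) \<le> 1 + 2 powr (-(2 * t \<xi> - q \<xi>))"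
          using qM t by (intro add_left_mono powr_mono) auto
        also have "\<dots> \<le> zeta_real (2 * t \<xi> - q \<xi>)" by (rule zeta_real_ge[OF dom])
        finally have "b \<le> ln (zeta_real (2 * t \<xi> - q \<xi>))"
          unfolding b_def by (intro ln_mono) (auto intro: add_pos_pos)
        moreover have "t \<xi> * ln 4 < \<tau> * ln 4" using True by (intro mult_strict_right_mono) auto
        ultimately have "0 < pressure (t \<xi>) (q \<xi>)"
          using pressure_ge[OF t(1) dom] \<tau>(3) by linarith
        \<comment> \<open>The two sides of
          \<open>pressure (t \<xi>) (q \<xi>) = q \<xi> * \<xi>\<close> now have opposite
          signs.\<close>
        moreover have "q \<xi> < 0" using True \<tau> dom by linarith
        ultimately show False
          unfolding eq[OF \<xi>(1)] using \<xi>(1) by (simp add: zero_less_mult_iff)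
      next
        case False
        have s: "1 < 2 * t \<xi> - (-K)" "K0 \<le> 2 * t \<xi> - (-K)" using t K by auto
        have "4 powr (-t \<xi>) \<le> (4::real) powr (-\<tau>)" using False by (intro powr_mono) auto
        then have less: "zeta_real (2 * t \<xi> - (-K)) ^ 2 + (4 powr (-t \<xi>) - 1) < \<rho>"
          using K0[OF s(2)] by linarith
        \<comment> \<open>Strict monotonicity of \<open>ln\<close> requires a positive argument;
          positivity comes from the partition sum that this expression bounds.\<close>
        have "0 < zeta_real (2 * t \<xi> - (-K)) ^ 2 + (4 powr (-t \<xi>) - 1)"
          by (rule less_le_trans[OF partition_sum_pos partition_sum_2_le]) (use t s in auto)
        then have "ln (zeta_real (2 * t \<xi> - (-K)) ^ 2 + (4 powr (-t \<xi>) - 1)) < ln \<rho>"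
          using less \<rho> by (subst ln_less_cancel_iff) auto
        then have "2 * (\<xi> * (-K)) < ln \<rho>"
          using pressure_le_pairs[OF t(1) s(1)] tangent[OF \<xi>(1) s(1)] by linarith
        moreover have "2 * (\<xi> * K) < - ln \<rho>" using \<xi>(2) K by (simp add: \<xi>0_def field_simps)
        ultimately show False by simp
      qed
    qed
    then show "\<forall>\<^sub>F \<xi> in at_right 0. q \<xi> < Z"
      unfolding eventually_at_right_field using \<open>0 < \<xi>0\<close> by blast
  qed

  show "(q \<longlongrightarrow> 0) at_top"
  proof (rule order_tendstoI)
    fix y :: real assume "y < 0"
    have "((\<lambda>\<xi>. - ln 4 / \<xi>) \<longlongrightarrow> (0::real)) at_top" by real_asymp
    then have "\<forall>\<^sub>F \<xi> in at_top. y < - ln 4 / \<xi>" using \<open>y < 0\<close> by (rule order_tendstoD(1))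
    then show "\<forall>\<^sub>F \<xi> in at_top. y < q \<xi>"
      using eventually_gt_at_top[of 0]
    proof eventually_elim
      case (elim \<xi>)
      note t = t[OF elim(2)] and dom = dom[OF elim(2)]
      have "0 \<le> ln (zeta_real (2 * t \<xi> - q \<xi>))"
        using zeta_real_ge_1[OF dom] by simp
      moreover have "t \<xi> * ln 4 \<le> 1 * ln 4" using t by (intro mult_right_mono) auto
      ultimately have "- ln 4 \<le> q \<xi> * \<xi>"
        using pressure_ge[OF t(1) dom] unfolding eq[OF elim(2)] by linarith
      then have "- ln 4 / \<xi> \<le> q \<xi>" using elim(2) by (simp add: field_simps)
      with elim(1) show ?case by linarith
    qed
  next
    fix y :: real assume y: "0 < y"
    \<comment> \<open>If \<open>q \<xi> \<ge> y\<close>, then \<open>2 * t \<xi> > 1 + y\<close>, so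
      \<open>y / 2\<close> is admissible with the margin \<open>y / 2\<close>, uniformly in
      \<open>t \<xi>\<close>. Beyond \<open>c\<close> the tangent line at \<open>y / 2\<close>
      exceeds the resulting bound on the pressure.\<close>
    define c where "c = ln (zeta_real (1 + y / 2)) / (y / 2)"
    show "\<forall>\<^sub>F \<xi> in at_top. q \<xi> < y"
      using eventually_gt_at_top[of 0] eventually_gt_at_top[of c]
    proof eventually_elim
      case (elim \<xi>)
      note t = t[OF elim(1)] and dom = dom[OF elim(1)]
      show ?case
      proof (rule ccontr)
        assume "\<not> q \<xi> < y"
        then have s: "1 < 2 * t \<xi> - y / 2" "1 + y / 2 \<le> 2 * t \<xi> - y / 2" using dom y by auto
        have "\<xi> * (y / 2) \<le> pressure (t \<xi>) (y / 2)" by (rule tangent[OF elim(1) s(1)])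
        also have "\<dots> \<le> ln (zeta_real (2 * t \<xi> - y / 2))" by (rule pressure_le[OF t(1) s(1)])
        also have "\<dots> \<le> ln (zeta_real (1 + y / 2))"
          using zeta_real_ge_1[OF s(1)] y s by (intro ln_mono zeta_real_antimono) auto
        finally have "\<xi> \<le> c" using y by (simp add: c_def field_simps)
        with elim(2) show False by simp
      qed
    qed
  qed
qed

end
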